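(* The angular momentum $\mathcal A=\langle J,\Lambda_1+\Lambda_R\rangle$ is conserved (constant in time) along the optimal trajectory (Pontryagin extremal) of the circular control problem.
   Context: Notation: $\langle X,Y\rangle=\mathrm{trace}(XY)$, $[X,Y]=XY-YX$ on $\mathfrak{sl}_2(\mathbb R)$; $J=\begin{pmatrix}0&-1\\ 1&0\end{pmatrix}$. Let $U_C=\{(u_0,u_1,u_2)\in\mathbb R^3:\ u_0+u_1+u_2=1,\ u_0^2+u_1^2+u_2^2\le1\}$ (the disk circumscribing the two-simplex), and for $u\in U_C$ let $Z_u=\begin{pmatrix}\frac{u_1-u_2}{\sqrt3}&\frac{u_0-2u_1-2u_2}{3}\\ u_0&\frac{u_2-u_1}{\sqrt3}\end{pmatrix}$. The circular control problem is the optimal control problem on $\mathrm{SL}_2(\mathbb R)\times\mathfrak{sl}_2(\mathbb R)$ with state equations $g'=gX$, $X'=[P,X]$, $P=Z_u/\langle Z_u,X\rangle$, measurable control $u(t)\in U_C$, and cost $-\frac32\int\langle J,X\rangle\,dt$. Here $\det X=1$, $\langle J,X\rangle<0$, and $X$ stays in the region where $\langle X,Z_v\rangle<0$ for all $v\in U_C$. A Pontryagin extremal is a trajectory lifted to $(g,X,\Lambda_1,\Lambda_R)$ with $\Lambda_1,\Lambda_R\in\mathfrak{sl}_2(\mathbb R)$, $\langle\Lambda_R,X\rangle=0$, and a constant $\lambda_{cost}\le0$, $(\lambda_{cost},\Lambda_1,\Lambda_R)$ nowhere zero, satisfying $$\Lambda_1'=[\Lambda_1,X],\qquad \Lambda_R'=[P,\Lambda_R]-\langle\Lambda_R,P\rangle[P,X]+[-\Lambda_1+\tfrac32\lambda_{cost}J,X],$$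 such that for almost every $t$ the control $u(t)$ maximizes over $v\in U_C$ the Hamiltonian $\langle\Lambda_1-\frac32\lambda_{cost}J,X\rangle-\frac{\langle\Lambda_R,Z_v\rangle}{\langle X,Z_v\rangle}$, whose maximal value is $0$. *)

theory Defs
  imports "HOL-Analysis.Analysis"
begin

type_synonym mat2 = "real^2^2"

definition sl2 :: "mat2 set" where
  "sl2 = {X. trace X = 0}"

definition trace_form :: "mat2 \<Rightarrow> mat2 \<Rightarrow> real" where
  "trace_form X Y = trace (X ** Y)"

definition bracket :: "mat2 \<Rightarrow> mat2 \<Rightarrow> mat2" where
  "bracket X Y = X ** Y - Y ** X"

definition J :: mat2 where
  "J = vector [vector [0, -1], vector [1, 0]]"

text \<open>The numeral type \<open>3\<close> has the elements \<open>0\<close>, \<open>1\<close>, \<open>2\<close> (and \<open>3 = 0\<close>), so the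
  coordinates of \<open>u :: real^3\<close> can be written \<open>u $ 0\<close>, \<open>u $ 1\<close>, \<open>u $ 2\<close>.\<close>

definition U_C :: "(real^3) set" where
  "U_C = {u. u $ 0 + u $ 1 + u $ 2 = 1 \<and> (u $ 0)\<^sup>2 + (u $ 1)\<^sup>2 + (u $ 2)\<^sup>2 \<le> 1}"

definition Z :: "real^3 \<Rightarrow> mat2" where
  "Z u = vector
    [vector [(u $ 1 - u $ 2) / sqrt 3, (u $ 0 - 2 * u $ 1 - 2 * u $ 2) / 3],
     vector [u $ 0,                    (u $ 2 - u $ 1) / sqrt 3]]"

definition P :: "real^3 \<Rightarrow> mat2 \<Rightarrow> mat2" where
  "P u X = Z u /\<^sub>R trace_form (Z u) X"

text \<open>The usual epsilon-delta absolute continuity on a compact interval; the finite families of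
  non-overlapping subintervals are the library's divisions of their own unions.\<close>

definition abs_continuous_on :: "real \<Rightarrow> real \<Rightarrow> (real \<Rightarrow> 'a::real_normed_vector) \<Rightarrow> bool" where
  "abs_continuous_on a b f \<longleftrightarrow>
    (\<forall>e>0. \<exists>d>0. \<forall>D. D division_of \<Union>D \<and> \<Union>D \<subseteq> {a..b} \<and> (\<Sum>K\<in>D. Sup K - Inf K) < d
      \<longrightarrow> (\<Sum>K\<in>D. norm (f (Sup K) - f (Inf K))) < e)"

text \<open>Solutions of differential equations with a merely measurable right-hand side are
  understood in the sense of Caratheodory: locally absolutely continuous curves satisfying the
  equation almost everywhere on the time interval \<open>T\<close>.\<close>

definition solves_ae ::
    "real set \<Rightarrow> (real \<Rightarrow> 'a::real_normed_vector) \<Rightarrow> (real \<Rightarrow> 'a) \<Rightarrow> bool" where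
  "solves_ae T f F \<longleftrightarrow>
    (\<forall>a b. {a..b} \<subseteq> T \<longrightarrow> abs_continuous_on a b f) \<and>
    (AE t in lebesgue_on T. (f has_vector_derivative F t) (at t within T))"

definition controlled_trajectory ::
    "real set \<Rightarrow> (real \<Rightarrow> real^3) \<Rightarrow> (real \<Rightarrow> mat2) \<Rightarrow> (real \<Rightarrow> mat2) \<Rightarrow> bool" where
  "controlled_trajectory T u g X \<longleftrightarrow>
    u \<in> borel_measurable (lebesgue_on T) \<and> (\<forall>t\<in>T. u t \<in> U_C) \<and>
    (\<forall>t\<in>T. det (g t) = 1) \<and>
    (\<forall>t\<in>T. X t \<in> sl2 \<and> det (X t) = 1 \<and> trace_form J (X t) < 0 \<and>
            (\<forall>v\<in>U_C. trace_form (X t) (Z v) < 0)) \<and>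
    solves_ae T g (\<lambda>t. g t ** X t) \<and>
    solves_ae T X (\<lambda>t. bracket (P (u t) (X t)) (X t))"

text \<open>The running cost \<open>- 3/2 * trace_form J X\<close> enters the extremality conditions only
  through the terms with the cost multiplier \<open>lcost\<close>.\<close>

definition hamiltonian :: "real \<Rightarrow> mat2 \<Rightarrow> mat2 \<Rightarrow> mat2 \<Rightarrow> real^3 \<Rightarrow> real" where
  "hamiltonian lcost X L1 LR v =
    trace_form (L1 - (3/2 * lcost) *\<^sub>R J) X - trace_form LR (Z v) / trace_form X (Z v)"

definition pontryagin_extremal ::
    "real set \<Rightarrow> (real \<Rightarrow> real^3) \<Rightarrow> (real \<Rightarrow> mat2) \<Rightarrow> (real \<Rightarrow> mat2) \<Rightarrow>
     (real \<Rightarrow> mat2) \<Rightarrow> (real \<Rightarrow> mat2) \<Rightarrow> real \<Rightarrow> bool" where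
  "pontryagin_extremal T u g X L1 LR lcost \<longleftrightarrow>
    controlled_trajectory T u g X \<and>
    (\<forall>t\<in>T. L1 t \<in> sl2 \<and> LR t \<in> sl2 \<and> trace_form (LR t) (X t) = 0) \<and>
    lcost \<le> 0 \<and>
    (\<forall>t\<in>T. \<not> (lcost = 0 \<and> L1 t = 0 \<and> LR t = 0)) \<and>
    solves_ae T L1 (\<lambda>t. bracket (L1 t) (X t)) \<and>
    solves_ae T LR (\<lambda>t. bracket (P (u t) (X t)) (LR t)
      - trace_form (LR t) (P (u t) (X t)) *\<^sub>R bracket (P (u t) (X t)) (X t)
      + bracket (- L1 t + (3/2 * lcost) *\<^sub>R J) (X t)) \<and>
    (AE t in lebesgue_on T.
      (\<forall>v\<in>U_C. hamiltonian lcost (X t) (L1 t) (LR t) v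
              \<le> hamiltonian lcost (X t) (L1 t) (LR t) (u t)) \<and>
      hamiltonian lcost (X t) (L1 t) (LR t) (u t) = 0)"

definition angular_momentum :: "mat2 \<Rightarrow> mat2 \<Rightarrow> real" where
  "angular_momentum L1 LR = trace_form J (L1 + LR)"

end

theory Submission
  imports Defs
begin

text \<open>Conjugation by the rotations \<open>exp (\<theta> J / 2)\<close> maps the control set \<open>{Z\<^sub>v. v \<in> U\<^sub>C}\<close> to itself, so the
  maximized Hamiltonian is critical in the direction \<open>[J, Z\<^sub>u]\<close>.  This first-order condition says
  exactly that the derivative \<open>\<langle>J, [P, \<Lambda>\<^sub>R - \<langle>\<Lambda>\<^sub>R, P\<rangle> X]\<rangle>\<close> of the angular momentum vanishes almost
  everywhere, and an absolutely continuous function with almost everywhere vanishing derivative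
  is constant.\<close>

section \<open>Absolutely continuous functions\<close>

lemma abs_continuous_on_add:
  assumes f: "abs_continuous_on a b f" and g: "abs_continuous_on a b g"
  shows "abs_continuous_on a b (\<lambda>t. f t + g t)"
  unfolding abs_continuous_on_def
proof (intro allI impI)
  fix e :: real assume "e > 0"
  then have e2: "e/2 > 0" by simp
  obtain d1 where d1: "d1 > 0" "\<And>D. D division_of \<Union>D \<and> \<Union>D \<subseteq> {a..b} \<and> (\<Sum>K\<in>D. Sup K - Inf K) < d1
      \<Longrightarrow> (\<Sum>K\<in>D. norm (f (Sup K) - f (Inf K))) < e/2"
    using f e2 unfolding abs_continuous_on_def by blast
  obtain d2 where d2: "d2 > 0" "\<And>D. D division_of \<Union>D \<and> \<Union>D \<subseteq> {a..b} \<and> (\<Sum>K\<in>D. Sup K - Inf K) < d2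
      \<Longrightarrow> (\<Sum>K\<in>D. norm (g (Sup K) - g (Inf K))) < e/2"
    using g e2 unfolding abs_continuous_on_def by blast
  show "\<exists>d>0. \<forall>D. D division_of \<Union>D \<and> \<Union>D \<subseteq> {a..b} \<and> (\<Sum>K\<in>D. Sup K - Inf K) < d
      \<longrightarrow> (\<Sum>K\<in>D. norm (f (Sup K) + g (Sup K) - (f (Inf K) + g (Inf K)))) < e"
  proof (intro exI[of _ "min d1 d2"] conjI allI impI)
    fix D assume D: "D division_of \<Union>D \<and> \<Union>D \<subseteq> {a..b} \<and> (\<Sum>K\<in>D. Sup K - Inf K) < min d1 d2"
    have "(\<Sum>K\<in>D. norm (f (Sup K) + g (Sup K) - (f (Inf K) + g (Inf K))))
      \<le> (\<Sum>K\<in>D. norm (f (Sup K) - f (Inf K)) + norm (g (Sup K) - g (Inf K)))"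
      by (intro sum_mono) (metis add_diff_add norm_triangle_ineq)
    also have "\<dots> < e"
      using d1(2)[of D] d2(2)[of D] D by (simp add: sum.distrib)
    finally show "(\<Sum>K\<in>D. norm (f (Sup K) + g (Sup K) - (f (Inf K) + g (Inf K)))) < e" .
  qed (use d1 d2 in auto)
qed

lemma abs_continuous_on_bounded_linear:
  assumes h: "bounded_linear h" and f: "abs_continuous_on a b f"
  shows "abs_continuous_on a b (\<lambda>t. h (f t))"
  unfolding abs_continuous_on_def
proof (intro allI impI)
  fix e :: real assume "e > 0"
  obtain C where C: "C > 0" "\<And>x. norm (h x) \<le> norm x * C"
    using bounded_linear.pos_bounded[OF h] by blast
  have "e / C > 0" using \<open>e > 0\<close> C by simp
  then obtain d where d: "d > 0" "\<And>D. D division_of \<Union>D \<and> \<Union>D \<subseteq> {a..b} \<and> (\<Sum>K\<in>D. Sup K - Inf K) < d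
      \<Longrightarrow> (\<Sum>K\<in>D. norm (f (Sup K) - f (Inf K))) < e / C"
    using f unfolding abs_continuous_on_def by blast
  have "(\<Sum>K\<in>D. norm (h (f (Sup K)) - h (f (Inf K)))) < e"
    if D: "D division_of \<Union>D \<and> \<Union>D \<subseteq> {a..b} \<and> (\<Sum>K\<in>D. Sup K - Inf K) < d" for D
  proof -
    have "(\<Sum>K\<in>D. norm (h (f (Sup K)) - h (f (Inf K))))
      \<le> (\<Sum>K\<in>D. norm (f (Sup K) - f (Inf K)) * C)"
      by (intro sum_mono) (metis C(2) h linear_diff bounded_linear.linear)
    also have "\<dots> = (\<Sum>K\<in>D. norm (f (Sup K) - f (Inf K))) * C"
      by (simp add: sum_distrib_right)
    also have "\<dots> < e"
      using d(2)[OF D] C by (simp add: pos_less_divide_eq)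
    finally show ?thesis .
  qed
  with d(1) show "\<exists>d>0. \<forall>D. D division_of \<Union>D \<and> \<Union>D \<subseteq> {a..b} \<and> (\<Sum>K\<in>D. Sup K - Inf K) < d
      \<longrightarrow> (\<Sum>K\<in>D. norm (h (f (Sup K)) - h (f (Inf K)))) < e" by blast
qed

text \<open>Cousin's lemma: the gauge keeps intervals tagged in the exceptional null set inside an open set
  of small measure, where absolute continuity applies, and the difference quotients small elsewhere.\<close>

lemma abs_continuous_on_zero_derivative_eq:
  fixes f :: "real \<Rightarrow> 'a::real_normed_vector"
  assumes ab: "a \<le> b" and f: "abs_continuous_on a b f" and N: "N \<in> null_sets lebesgue"
    and deriv: "\<And>t. t \<in> {a..b} - N \<Longrightarrow> (f has_vector_derivative 0) (at t within {a..b})"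
  shows "f a = f b"
proof -
  \<comment> \<open>The term \<open>e\<close> pays for the pieces tagged in \<open>N\<close>, the
    term \<open>e * (b - a)\<close> for all others.\<close>
  have le: "norm (f b - f a) \<le> e + e * (b - a)" if "e > 0" for e
  proof -
    obtain d where d: "d > 0" "\<And>D. D division_of \<Union>D \<and> \<Union>D \<subseteq> {a..b} \<and> (\<Sum>K\<in>D. Sup K - Inf K) < d
      \<Longrightarrow> (\<Sum>K\<in>D. norm (f (Sup K) - f (Inf K))) < e"
      using f \<open>e > 0\<close> unfolding abs_continuous_on_def by blast
    have N_meas: "N \<in> lmeasurable"
      using N by (rule fmeasurableI_null_sets)
    \<comment> \<open>Outer regularity bounds \<open>G - N\<close>; since \<open>N\<close> is null,
      the bound passes to \<open>G\<close> itself.\<close>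
    obtain G where G: "open G" "N \<subseteq> G" and diff: "G - N \<in> lmeasurable" "emeasure lebesgue (G - N) < ennreal d"
      using sets_lebesgue_outer_open[of N d] N d(1) by blast
    have G_meas: "G \<in> lmeasurable"
      using fmeasurable_Diff_D[OF diff(1) N_meas G(2)] .
    have "measure lebesgue (G - N) < d"
      using diff d(1) by (simp add: emeasure_eq_measure2 ennreal_less_iff)
    then have G_small: "measure lebesgue G < d"
      using measure_Diff_null_set[OF fmeasurableD[OF G_meas] N] by simp
    have "\<exists>r>0. if t \<in> N then ball t r \<subseteq> G else t \<in> {a..b} \<longrightarrow>
        (\<forall>y\<in>{a..b}. \<bar>y - t\<bar> < r \<longrightarrow> norm (f y - f t) \<le> e * \<bar>y - t\<bar>)" for t
    proof (cases "t \<in> N")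
      case True
      then show ?thesis using G by (meson openE subsetD)
    next
      case False
      show ?thesis
      proof (cases "t \<in> {a..b}")
        case True
        with False deriv[of t] have "(f has_derivative (\<lambda>h. 0)) (at t within {a..b})"
          by (simp add: has_vector_derivative_def)
        with \<open>e > 0\<close> False show ?thesis
          unfolding has_derivative_within_alt by fastforce
      \<comment> \<open>A gauge is defined on the whole line, but outside \<open>N\<close> and
        \<open>{a..b}\<close> nothing is required of it; the radius 1 is arbitrary.\<close>
      qed (use False in \<open>auto intro: exI[of _ 1]\<close>)
    qed
    then obtain r where r: "\<And>t. r t > 0"
      and rN: "\<And>t. t \<in> N \<Longrightarrow> ball t (r t) \<subseteq> G"
      and rd: "\<And>t y. \<lbrakk>t \<notin> N; t \<in> {a..b}; y \<in> {a..b}; \<bar>y - t\<bar> < r t\<rbrakk> \<Longrightarrow> norm (f y - f t) \<le> e * \<bar>y - t\<bar>"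
      by metis
    have "gauge (\<lambda>t. ball t (r t))" using r by (auto intro: gauge_ball_dependent)
    then obtain p where p: "p tagged_division_of {a..b}" and fine: "(\<lambda>t. ball t (r t)) fine p"
      using fine_division_exists_real by metis
    have fin: "finite p" using p by blast
    define q where "q = {(t,K)\<in>p. t \<in> N}"
    have qp: "q \<subseteq> p" by (auto simp: q_def)
    have int: "\<exists>u v. K = {u..v} \<and> u \<le> t \<and> t \<le> v \<and> a \<le> u \<and> v \<le> b" if tK: "(t,K) \<in> p" for t K
    proof -
      obtain u v where K: "K = {u..v}"
        using tagged_division_ofD(4)[OF p tK] by auto
      have "t \<in> {u..v}" "{u..v} \<subseteq> {a..b}"
        using tagged_division_ofD(2,3)[OF p tK] K by auto
      then show ?thesis using K by auto
    qed
    have q: "q tagged_partial_division_of {a..b}"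
      using p qp unfolding tagged_division_of_def by (blast intro: tagged_partial_division_subset)
    have div: "snd ` q division_of \<Union>(snd ` q)"
      using q by (rule partial_division_of_tagged_division)
    have sub: "\<Union>(snd ` q) \<subseteq> {a..b}"
      using qp int by fastforce
    have subG: "\<Union>(snd ` q) \<subseteq> G"
      using rN fine unfolding q_def fine_def by fastforce
    have len: "Sup K - Inf K = measure lebesgue K" if "K \<in> snd ` q" for K
    proof -
      from that obtain t where "(t,K) \<in> p" using qp by force
      from int[OF this] show ?thesis by auto
    qed
    have "(\<Sum>K\<in>snd ` q. Sup K - Inf K) = (\<Sum>K\<in>snd ` q. measure lebesgue K)"
      using len by (intro sum.cong) auto
    also have "\<dots> = measure lebesgue (\<Union>(snd ` q))"
      using content_division[OF div] .
    also have "\<dots> \<le> measure lebesgue G"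
      using subG G_meas div by (intro measure_mono_fmeasurable) (auto intro: fmeasurableD lmeasurable_division)
    finally have "(\<Sum>K\<in>snd ` q. Sup K - Inf K) < d" using G_small by simp
    with d(2)[of "snd ` q"] div sub
    have "(\<Sum>K\<in>snd ` q. norm (f (Sup K) - f (Inf K))) < e" by simp
    moreover have "(\<Sum>(t,K)\<in>q. norm (f (Sup K) - f (Inf K))) = (\<Sum>K\<in>snd ` q. norm (f (Sup K) - f (Inf K)))"
    proof -
      \<comment> \<open>The sum over \<open>q\<close> counts an interval once per tag, the sum over
        its image under \<open>snd\<close> only once. Distinct tags can share an interval only if
        its interior is empty, so the summand must vanish there. One-point intervals comply by
        themselves; the empty set, where \<open>Sup\<close> and \<open>Inf\<close> carry no meaning,
        gets the default 0.\<close>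
      define d where "d K = (if K = {} then 0 else norm (f (Sup K) - f (Inf K)))" for K
      have ne: "K \<noteq> {}" if "(t,K) \<in> q" for t K
        using tagged_partial_division_ofD(2)[OF q that] by blast
      have "(\<Sum>(t,K)\<in>q. d K) = (\<Sum>K\<in>snd ` q. d K)"
        by (rule sum.over_tagged_division_lemma[OF tagged_partial_division_of_Union_self[OF q]])
          (auto simp: box_eq_empty d_def less_eq_real_def)
      moreover have "(\<Sum>(t,K)\<in>q. d K) = (\<Sum>(t,K)\<in>q. norm (f (Sup K) - f (Inf K)))"
        using ne by (intro sum.cong) (auto simp: d_def)
      moreover have "(\<Sum>K\<in>snd ` q. d K) = (\<Sum>K\<in>snd ` q. norm (f (Sup K) - f (Inf K)))"
        using ne by (intro sum.cong) (auto simp: d_def)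
      ultimately show ?thesis by simp
    qed
    ultimately have N_part: "(\<Sum>(t,K)\<in>q. norm (f (Sup K) - f (Inf K))) < e" by simp
    have "(\<Sum>(t,K)\<in>p - q. norm (f (Sup K) - f (Inf K))) \<le> (\<Sum>(t,K)\<in>p - q. e * (Sup K - Inf K))"
    proof (intro sum_mono, clarify)
      fix t K assume tK: "(t,K) \<in> p" "(t,K) \<notin> q"
      then obtain u v where K: "K = {u..v}" and uv: "u \<le> t" "t \<le> v" "a \<le> u" "v \<le> b"
        using int by blast
      have "t \<notin> N" using tK by (auto simp: q_def)
      have "{u..v} \<subseteq> ball t (r t)" using fine tK K by (auto simp: fine_def)
      then have "u \<in> ball t (r t)" "v \<in> ball t (r t)" using uv by (meson atLeastAtMost_iff order.trans order.refl subsetD)+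
      then have "norm (f u - f t) \<le> e * \<bar>u - t\<bar>" "norm (f v - f t) \<le> e * \<bar>v - t\<bar>"
        using rd[OF \<open>t \<notin> N\<close>, of u] rd[OF \<open>t \<notin> N\<close>, of v] uv
        by (auto simp: dist_real_def)
      \<comment> \<open>The tag lies between the endpoints, so its distances to them add up to
        exactly \<open>v - u\<close>.\<close>
      moreover have "norm (f v - f u) \<le> norm (f v - f t) + norm (f u - f t)"
        by (metis norm_triangle_ineq4 diff_diff_eq2 diff_add_cancel)
      ultimately have "norm (f v - f u) \<le> e * (v - u)"
        using uv by (simp add: algebra_simps)
      then show "norm (f (Sup K) - f (Inf K)) \<le> e * (Sup K - Inf K)"
        using K uv by simp
    qed
    also have "\<dots> \<le> (\<Sum>(t,K)\<in>p. e * (Sup K - Inf K))"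
      using fin \<open>e > 0\<close> int by (intro sum_mono2) fastforce+
    also have "\<dots> = e * (\<Sum>(t,K)\<in>p. Sup K - Inf K)"
      by (simp add: sum_distrib_left case_prod_unfold)
    also have "\<dots> = e * (b - a)"
      using additive_tagged_division_1[OF ab p, of "\<lambda>x. x"] by simp
    finally have off_N: "(\<Sum>(t,K)\<in>p - q. norm (f (Sup K) - f (Inf K))) \<le> e * (b - a)" .
    \<comment> \<open>The increments of \<open>f\<close> telescope over the division, just as the
      lengths did above for the identity function.\<close>
    have "norm (f b - f a) = norm (\<Sum>(t,K)\<in>p. f (Sup K) - f (Inf K))"
      using additive_tagged_division_1[OF ab p, of f] by simp
    also have "\<dots> \<le> (\<Sum>(t,K)\<in>p. norm (f (Sup K) - f (Inf K)))"
      by (metis (no_types, lifting) norm_sum sum.cong case_prod_unfold)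
    also have "\<dots> = (\<Sum>(t,K)\<in>p - q. norm (f (Sup K) - f (Inf K))) + (\<Sum>(t,K)\<in>q. norm (f (Sup K) - f (Inf K)))"
      using sum.subset_diff[OF qp fin] .
    finally show ?thesis using N_part off_N by simp
  qed
  have "norm (f b - f a) \<le> 0"
  proof (rule field_le_epsilon)
    fix e :: real assume "e > 0"
    \<comment> \<open>This tolerance makes the two contributions add up to \<open>e\<close>; the
      summand 1 keeps the denominator positive when \<open>a = b\<close>.\<close>
    then have "e / (1 + (b - a)) > 0" using ab by simp
    from le[OF this] have "norm (f b - f a) \<le> e / (1 + (b - a)) * (1 + (b - a))"
      by (simp only: distrib_left mult_1_right)
    then show "norm (f b - f a) \<le> 0 + e" using ab by simp
  qed
  then show ?thesis by simp
qed

section \<open>Solutions of differential equations\<close>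

lemma solves_ae_add:
  assumes "solves_ae T f F" "solves_ae T g G"
  shows "solves_ae T (\<lambda>t. f t + g t) (\<lambda>t. F t + G t)"
  using assms unfolding solves_ae_def
  by (auto intro: abs_continuous_on_add has_vector_derivative_add elim!: eventually_elim2)

lemma solves_ae_bounded_linear:
  assumes "bounded_linear h" "solves_ae T f F"
  shows "solves_ae T (\<lambda>t. h (f t)) (\<lambda>t. h (F t))"
  using assms unfolding solves_ae_def
  by (auto intro: abs_continuous_on_bounded_linear bounded_linear.has_vector_derivative elim!: eventually_mono)

text \<open>Two points of \<open>T\<close> span a compact interval inside \<open>T\<close>, and a
  derivative within \<open>T\<close> restricts to it. So the compact case suffices, with one null
  set for all pairs of points, even if \<open>T\<close> is open or unbounded.\<close>

lemma solves_ae_zero_constant_on: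
  assumes T: "is_interval T" and f: "solves_ae T f F" and F: "AE t in lebesgue_on T. F t = 0"
  shows "f constant_on T"
proof -
  have meas: "T \<in> sets lebesgue"
    using real_interval_borel_measurable[OF T] by simp
  have "AE t in lebesgue_on T. (f has_vector_derivative 0) (at t within T)"
    using f F unfolding solves_ae_def by (auto elim!: eventually_elim2)
  then have "AE t in lebesgue. t \<in> T \<longrightarrow> (f has_vector_derivative 0) (at t within T)"
    using meas by (simp add: AE_restrict_space_iff)
  then obtain N where N: "N \<in> null_sets lebesgue"
    and deriv: "\<And>t. t \<in> space lebesgue - N \<Longrightarrow> t \<in> T \<longrightarrow> (f has_vector_derivative 0) (at t within T)"
    by (rule AE_E3) (rule that)
  have eq: "f a = f b" if "a \<le> b" "a \<in> T" "b \<in> T" for a b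
  proof (rule abs_continuous_on_zero_derivative_eq[OF that(1) _ N])
    have sub: "{a..b} \<subseteq> T" by (meson T atLeastAtMost_iff is_interval_1 subsetI that(2,3))
    then show "abs_continuous_on a b f" using f by (simp add: solves_ae_def)
    show "(f has_vector_derivative 0) (at t within {a..b})" if "t \<in> {a..b} - N" for t
    proof -
      have "(f has_vector_derivative 0) (at t within T)"
        using that deriv[of t] sub by auto
      then show ?thesis using sub by (rule has_vector_derivative_within_subset)
    qed
  qed
  show ?thesis
    unfolding constant_on_def using eq by (metis linear)
qed

section \<open>Rotations of the control set\<close>

lemma trace_form_eq:
  "trace_form A B = A$1$1 * B$1$1 + A$1$2 * B$2$1 + A$2$1 * B$1$2 + A$2$2 * B$2$2"
  by (simp add: trace_form_def trace_def matrix_matrix_mult_def sum_2)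

lemma trace_form_bilinear: "bounded_bilinear trace_form"
  by (rule bilinear_conv_bounded_bilinear[THEN iffD1])
    (auto simp: bilinear_def trace_form_eq algebra_simps intro!: linearI)

lemmas trace_form_simps =
  bounded_bilinear.add_left[OF trace_form_bilinear]
  bounded_bilinear.add_right[OF trace_form_bilinear]
  bounded_bilinear.diff_left[OF trace_form_bilinear]
  bounded_bilinear.diff_right[OF trace_form_bilinear]
  bounded_bilinear.minus_left[OF trace_form_bilinear]
  bounded_bilinear.minus_right[OF trace_form_bilinear]
  bounded_bilinear.scaleR_left[OF trace_form_bilinear]
  bounded_bilinear.scaleR_right[OF trace_form_bilinear]

lemma trace_form_commute: "trace_form A B = trace_form B A"
  by (simp add: trace_form_eq algebra_simps)

lemma bracket_component:
  "bracket A B $ i $ j = A$i$1 * B$1$j + A$i$2 * B$2$j - (B$i$1 * A$1$j + B$i$2 * A$2$j)"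
  by (simp add: bracket_def matrix_matrix_mult_def sum_2)

text \<open>Invariance of the trace form, a consequence of the cyclicity of the trace. It turns
  pairings of \<open>J\<close> with brackets into pairings with the rotation direction
  \<open>bracket J (Z u)\<close>.\<close>

lemma trace_form_bracket: "trace_form A (bracket B C) = trace_form (bracket A B) C"
  by (simp add: trace_form_eq bracket_component algebra_simps)

lemma bracket_simps:
  "bracket (A + B) C = bracket A C + bracket B C"
  "bracket (A - B) C = bracket A C - bracket B C"
  "bracket C (A - B) = bracket C A - bracket C B"
  "bracket (- A) C = - bracket A C"
  "bracket (c *\<^sub>R A) C = c *\<^sub>R bracket A C"
  "bracket C (c *\<^sub>R A) = c *\<^sub>R bracket C A"
  "bracket A A = 0"
  by (simp_all add: vec_eq_iff bracket_component algebra_simps)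

lemma J_component: "J$1$1 = 0" "J$1$2 = -1" "J$2$1 = 1" "J$2$2 = 0"
  by (simp_all add: J_def)

lemma Z_component:
  "Z u$1$1 = (u$1 - u$2) / sqrt 3" "Z u$1$2 = (u$0 - 2 * u$1 - 2 * u$2) / 3"
  "Z u$2$1 = u$0" "Z u$2$2 = (u$2 - u$1) / sqrt 3"
  by (simp_all add: Z_def)

text \<open>A disk in the affine plane orthogonal to \<open>J\<close> through \<open>J / 3\<close>.\<close>

lemma Z_image_U_C:
  "Z ` U_C = {M. M$1$1 + M$2$2 = 0 \<and> M$2$1 - M$1$2 = 2/3 \<and>
                 (M$1$1)\<^sup>2 + ((M$1$2 + M$2$1) / 2)\<^sup>2 \<le> 4/9}" (is "_ = ?D")
proof (intro equalityI subsetI)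
  fix M assume "M \<in> Z ` U_C"
  then obtain u where u: "u \<in> U_C" and M: "M = Z u" by blast
  have s: "u$0 = 1 - u$1 - u$2" using u by (simp add: U_C_def)
  have "(1 - u$1 - u$2)\<^sup>2 + (u$1)\<^sup>2 + (u$2)\<^sup>2 \<le> 1" using u s by (simp add: U_C_def)
  then show "M \<in> ?D"
    by (simp add: M Z_component s power_divide field_simps power2_eq_square)
next
  fix M assume M: "M \<in> ?D"
  \<comment> \<open>The witness solves \<open>u$0 = M$2$1\<close>,
    \<open>u$1 - u$2 = sqrt 3 * M$1$1\<close> and \<open>u$1 + u$2 = 1 - M$2$1\<close>. Coordinate 0
    is listed last because \<open>vector\<close> counts from 1 and the index 3 equals 0.\<close>
  define u :: "real^3" where
    "u = vector [(1 - M$2$1 + sqrt 3 * M$1$1) / 2, (1 - M$2$1 - sqrt 3 * M$1$1) / 2, M$2$1]"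
  have three: "(3::3) = 0" by simp
  have u: "u$1 = (1 - M$2$1 + sqrt 3 * M$1$1) / 2" "u$2 = (1 - M$2$1 - sqrt 3 * M$1$1) / 2"
    "u$0 = M$2$1"
    unfolding u_def using vector_3[where 'a=real] three by metis+
  have M': "M$2$2 = - M$1$1" "M$1$2 = M$2$1 - 2/3" using M by auto
  have "Z u = M"
    by (simp add: vec_eq_iff forall_2 Z_component u M' field_simps)
  moreover have "u \<in> U_C"
  proof -
    have "(M$1$2 + M$2$1) / 2 = M$2$1 - 1/3" using M' by simp
    with M have "(M$1$1)\<^sup>2 + (M$2$1 - 1/3)\<^sup>2 \<le> 4/9" by (metis (no_types, lifting) mem_Collect_eq)
    \<comment> \<open>The summand 1/3 is the squared norm of the center (1/3, 1/3, 1/3) of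
      \<open>U_C\<close>, which \<open>Z\<close> sends to \<open>J / 3\<close>. The bound 4/9 then
      gives 2/3 + 1/3 = 1.\<close>
    moreover have "(u$0)\<^sup>2 + (u$1)\<^sup>2 + (u$2)\<^sup>2
        = 3/2 * ((M$1$1)\<^sup>2 + (M$2$1 - 1/3)\<^sup>2) + 1/3"
      unfolding u by (simp add: power2_eq_square field_simps)
    ultimately have "(u$0)\<^sup>2 + (u$1)\<^sup>2 + (u$2)\<^sup>2 \<le> 3/2 * (4/9) + 1/3"
      by (metis add_right_mono mult_left_mono zero_le_divide_iff zero_le_numeral)
    moreover have "u$0 + u$1 + u$2 = 1" unfolding u by (simp add: field_simps)
    ultimately show ?thesis by (simp add: U_C_def)
  qed
  ultimately show "M \<in> Z ` U_C" by blast
qed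

text \<open>\<open>?R\<close> is the conjugate of \<open>M\<close> by the exponential of
  \<open>(\<theta> / 2) *\<^sub>R J\<close> in closed form: the component \<open>J / 3\<close> is
  fixed, and on the plane orthogonal to \<open>J\<close> half the bracket with \<open>J\<close> is a
  quarter turn. The disk is centered at \<open>J / 3\<close>, hence invariant.\<close>

lemma Z_image_U_C_rotate:
  assumes "M \<in> Z ` U_C"
  shows "(1/3) *\<^sub>R J + cos \<theta> *\<^sub>R (M - (1/3) *\<^sub>R J) + (sin \<theta> / 2) *\<^sub>R bracket J M \<in> Z ` U_C"
    (is "?R \<in> _")
proof -
  define x y where "x = M$1$1" and "y = M$2$1 - 1/3"
  have M: "M$1$1 = x" "M$2$2 = - x" "M$2$1 = y + 1/3" "M$1$2 = y - 1/3"
    and xy: "x\<^sup>2 + y\<^sup>2 \<le> 4/9"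
  proof -
    have "(M$1$2 + M$2$1) / 2 = y" using assms by (simp add: Z_image_U_C y_def)
    then show "x\<^sup>2 + y\<^sup>2 \<le> 4/9" using assms by (simp add: Z_image_U_C x_def)
  qed (use assms in \<open>auto simp: Z_image_U_C x_def y_def\<close>)
  have R: "?R$1$1 = cos \<theta> * x - sin \<theta> * y" "?R$2$2 = - (cos \<theta> * x - sin \<theta> * y)"
    "?R$1$2 = cos \<theta> * y + sin \<theta> * x - 1/3" "?R$2$1 = cos \<theta> * y + sin \<theta> * x + 1/3"
    by (simp_all add: bracket_component J_component M field_simps)
  have y: "(?R$1$2 + ?R$2$1) / 2 = cos \<theta> * y + sin \<theta> * x"
    unfolding R by simp
  have "(cos \<theta> * x - sin \<theta> * y)\<^sup>2 + (cos \<theta> * y + sin \<theta> * x)\<^sup>2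
      = ((sin \<theta>)\<^sup>2 + (cos \<theta>)\<^sup>2) * (x\<^sup>2 + y\<^sup>2)"
    by algebra
  then show ?thesis
    using xy unfolding Z_image_U_C mem_Collect_eq y unfolding R by simp
qed

section \<open>Conservation of angular momentum\<close>

text \<open>Along the orbit of \<open>Z u\<close> under rotation the quotient in the Hamiltonian is
  stationary at angle 0. The claim is the vanishing numerator of the quotient rule.\<close>

lemma hamiltonian_max_critical:
  assumes u: "u \<in> U_C" and neg: "\<forall>v\<in>U_C. trace_form X (Z v) < 0"
    and max: "\<forall>v\<in>U_C. hamiltonian lcost X L1 LR v \<le> hamiltonian lcost X L1 LR u"
  shows "trace_form LR (bracket J (Z u)) * trace_form X (Z u)
       = trace_form LR (Z u) * trace_form X (bracket J (Z u))"
proof -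
  define R where "R \<theta> = (1/3) *\<^sub>R J + cos \<theta> *\<^sub>R (Z u - (1/3) *\<^sub>R J) + (sin \<theta> / 2) *\<^sub>R bracket J (Z u)" for \<theta>
  define \<phi> where "\<phi> \<theta> = trace_form LR (R \<theta>) / trace_form X (R \<theta>)" for \<theta>
  have R0: "R 0 = Z u" by (simp add: R_def)
  have ne: "trace_form X (Z u) \<noteq> 0" using u neg by auto
  \<comment> \<open>The Hamiltonian is a term independent of the control minus this quotient, so its
    maximum is a minimum of \<open>\<phi>\<close>.\<close>
  have "\<phi> 0 \<le> \<phi> \<theta>" for \<theta>
  proof -
    obtain v where v: "v \<in> U_C" "R \<theta> = Z v"
      using Z_image_U_C_rotate[of "Z u" \<theta>] u unfolding R_def by blast
    then show ?thesis
      using max by (auto simp: \<phi>_def R0 hamiltonian_def)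
  qed
  moreover have D: "((\<lambda>\<theta>. trace_form A (R \<theta>)) has_real_derivative trace_form A (bracket J (Z u)) / 2) (at 0)" for A
    unfolding R_def trace_form_simps by (auto intro!: derivative_eq_intros)
  have "(\<phi> has_real_derivative
      (trace_form LR (bracket J (Z u)) / 2 * trace_form X (R 0)
       - trace_form LR (R 0) * (trace_form X (bracket J (Z u)) / 2))
      / (trace_form X (R 0) * trace_form X (R 0))) (at 0)"
    unfolding \<phi>_def by (rule DERIV_divide[OF D D]) (use ne R0 in simp)
  ultimately have "(trace_form LR (bracket J (Z u)) / 2 * trace_form X (R 0)
       - trace_form LR (R 0) * (trace_form X (bracket J (Z u)) / 2))
      / (trace_form X (R 0) * trace_form X (R 0)) = 0"
    \<comment> \<open>The minimum is global, so the radius 1 of the neighbourhood is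
      arbitrary.\<close>
    by (intro DERIV_local_min[of \<phi> _ 0 1]) auto
  then show ?thesis using ne by (simp add: R0)
qed

text \<open>The two brackets of \<open>L1\<close> with \<open>X\<close> cancel, and the term with
  \<open>c\<close> dies because \<open>bracket J J = 0\<close>. By invariance the rest pairs
  \<open>bracket J (P u X)\<close> with \<open>LR - trace_form LR (P u X) *\<^sub>R X\<close>; this
  is the criticality condition after division by the square of \<open>z\<close>.\<close>

lemma angular_momentum_derivative_zero:
  assumes u: "u \<in> U_C" and neg: "\<forall>v\<in>U_C. trace_form X (Z v) < 0"
    and max: "\<forall>v\<in>U_C. hamiltonian lcost X L1 LR v \<le> hamiltonian lcost X L1 LR u"
  shows "trace_form J (bracket L1 X + (bracket (P u X) LR - trace_form LR (P u X) *\<^sub>R bracket (P u X) X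
      + bracket (- L1 + c *\<^sub>R J) X)) = 0"
proof -
  define z where "z = trace_form (Z u) X"
  have z: "z \<noteq> 0" "trace_form X (Z u) = z"
    using u neg trace_form_commute[of "Z u" X] unfolding z_def by auto
  have P: "P u X = inverse z *\<^sub>R Z u" by (simp add: P_def z_def)
  have "trace_form J (bracket J X) = 0"
    unfolding trace_form_bracket bracket_simps by (simp add: trace_form_eq)
  moreover have "trace_form (bracket J (Z u)) LR = inverse z * trace_form LR (Z u) * trace_form (bracket J (Z u)) X"
    using hamiltonian_max_critical[OF assms] z
    by (simp add: trace_form_commute[of "bracket J (Z u)"] field_simps)
  ultimately show ?thesis
    by (simp add: P trace_form_bracket trace_form_simps bracket_simps)
qed

theorem theorem9p1p6:
  fixes T :: "real set" and u :: "real \<Rightarrow> real^3"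
    and g X L1 LR :: "real \<Rightarrow> mat2" and lcost :: real
  assumes "is_interval T"
    and "pontryagin_extremal T u g X L1 LR lcost"
  shows "(\<lambda>t. angular_momentum (L1 t) (LR t)) constant_on T"
proof -
  have L: "solves_ae T L1 (\<lambda>t. bracket (L1 t) (X t))"
    "solves_ae T LR (\<lambda>t. bracket (P (u t) (X t)) (LR t)
      - trace_form (LR t) (P (u t) (X t)) *\<^sub>R bracket (P (u t) (X t)) (X t)
      + bracket (- L1 t + (3/2 * lcost) *\<^sub>R J) (X t))"
    and adm: "\<And>t. t \<in> T \<Longrightarrow> u t \<in> U_C \<and> (\<forall>v\<in>U_C. trace_form (X t) (Z v) < 0)"
    and max: "AE t in lebesgue_on T. \<forall>v\<in>U_C. hamiltonian lcost (X t) (L1 t) (LR t) v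
              \<le> hamiltonian lcost (X t) (L1 t) (LR t) (u t)"
    using assms(2) unfolding pontryagin_extremal_def controlled_trajectory_def by auto
  have lin: "bounded_linear (trace_form J)"
    using trace_form_bilinear by (rule bounded_bilinear.bounded_linear_right)
  show ?thesis
    unfolding angular_momentum_def
  \<comment> \<open>Applying the linear map \<open>trace_form J\<close> to the sum of the two
    adjoint equations gives an equation for the angular momentum; it remains to see that its
    right-hand side vanishes almost everywhere.\<close>
  proof (rule solves_ae_zero_constant_on[OF assms(1) solves_ae_bounded_linear[OF lin solves_ae_add[OF L]]])
    show "AE t in lebesgue_on T. trace_form J (bracket (L1 t) (X t) + (bracket (P (u t) (X t)) (LR t)
      - trace_form (LR t) (P (u t) (X t)) *\<^sub>R bracket (P (u t) (X t)) (X t)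
      + bracket (- L1 t + (3/2 * lcost) *\<^sub>R J) (X t))) = 0"
      using max AE_space
    proof eventually_elim
      case (elim t)
      then show ?case
        using adm by (intro angular_momentum_derivative_zero) auto
    qed
  qed
qed

end
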